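(* Let $(M,*,0,\leq)$ be a dense unital magma and $(G,+)$ an $M$-normed abelian group. Then the following statements hold: (1) The set $\mathrm{Cauchy}(G)$ of all Cauchy sequences of $G$ is a subgroup of $\mathrm{Seq}(G)$. (2) If $(x_n)$ and $(y_n)$ are sequences in $G$ convergent to $a$ and $b$ in $G$, respectively, then the sequence $(x_n+y_n)$ is convergent to $a+b$. (3) The set $\mathrm{Conv}(G)$ of convergent sequences in $G$ is a subgroup of $\mathrm{Cauchy}(G)$. (4) If $\mathrm{Zero}(G)$ is the set of all sequences in $\mathrm{Conv}(G)$ which are convergent to $0\in G$, then $\mathrm{Zero}(G)$ is a subgroup of $\mathrm{Conv}(G)$ and $\mathrm{Conv}(G)/\mathrm{Zero}(G)\cong G$ (as groups).
   Context: A unital magma $(M,*,0)$ is a set $M$ with a binary operation $*$ (not necessarily associative or commutative) and an element $0$ with $m*0=0*m=m$ for all $m$. An ordered unital magma $(M,*,0,\leq)$ is a unital magma with a partial ordering $\leq$ such that $a\leq b$ implies $a*c\leq b*c$ and $c*a\leq c*b$ for all $a,b,c\in M$. Write $a<b$ if $a\leq b$ and $a\neq b$; $m$ is positive if $0<m$. An ordered unital magma $M$ is a dense unital magma if for every positive $\epsilon\in M$ there are positive $\beta,\gamma\in M$ with $\beta*\gamma<\epsilon$. A group $(G,+)$ is an $M$-normed group if there is a function $\Vert\cdot\Vert:G\to M$ such that (1) $\Vert g\Vert\geq 0$ for all $g\in G$, and $\Vert g\Vert=0$ if and only if $g=0$; (2) $\Vert g-h\Vert\leq\Vert g\Vert*\Vert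 h\Vert$ for all $g,h\in G$. Convergence and the Cauchy property in $G$ are with respect to $d(g,h)=\Vert g-h\Vert$: $(x_n)$ is convergent to $a\in G$ if for any positive $\epsilon\in M$ there is a natural number $N$ such that $n\geq N$ implies $\Vert x_n-a\Vert<\epsilon$; $(x_n)$ is Cauchy if for any positive $\epsilon\in M$ there is a natural number $N$ such that $m,n\geq N$ implies $\Vert x_m-x_n\Vert<\epsilon$. $\mathrm{Seq}(G)$ is the abelian group of all sequences in $G$ under component-wise addition. *)

theory Defs
  imports "HOL-Algebra.Product_Groups"
begin

no_notation lesspoll (infixl \<open>\<prec>\<close> 50)

record 'm ord_magma = "'m partial_object" +
  magma_op :: "'m \<Rightarrow> 'm \<Rightarrow> 'm"  (infixl \<open>\<star>\<index>\<close> 70)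
  magma_zero :: 'm  (\<open>\<^bold>0\<index>\<close>)
  magma_le :: "'m \<Rightarrow> 'm \<Rightarrow> bool"  (infix \<open>\<preceq>\<index>\<close> 50)

locale unital_magma =
  fixes M :: "('m, 'b) ord_magma_scheme" (structure)
  assumes op_closed: "\<lbrakk>a \<in> carrier M; b \<in> carrier M\<rbrakk> \<Longrightarrow> a \<star> b \<in> carrier M"
    and zero_closed: "\<^bold>0 \<in> carrier M"
    and op_zero: "m \<in> carrier M \<Longrightarrow> m \<star> \<^bold>0 = m"
    and zero_op: "m \<in> carrier M \<Longrightarrow> \<^bold>0 \<star> m = m"

locale ordered_unital_magma = unital_magma +
  assumes le_refl: "reflp_on (carrier M) (\<preceq>)"
    and le_antisym: "antisymp_on (carrier M) (\<preceq>)"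
    and le_trans: "transp_on (carrier M) (\<preceq>)"
    and op_right_mono:
      "\<lbrakk>a \<in> carrier M; b \<in> carrier M; c \<in> carrier M; a \<preceq> b\<rbrakk> \<Longrightarrow> a \<star> c \<preceq> b \<star> c"
    and op_left_mono:
      "\<lbrakk>a \<in> carrier M; b \<in> carrier M; c \<in> carrier M; a \<preceq> b\<rbrakk> \<Longrightarrow> c \<star> a \<preceq> c \<star> b"

definition magma_less :: "('m, 'b) ord_magma_scheme \<Rightarrow> 'm \<Rightarrow> 'm \<Rightarrow> bool"  (infix \<open>\<prec>\<index>\<close> 50)
  where "a \<prec>\<^bsub>M\<^esub> b \<longleftrightarrow> a \<preceq>\<^bsub>M\<^esub> b \<and> a \<noteq> b"

definition positives :: "('m, 'b) ord_magma_scheme \<Rightarrow> 'm set"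
  where "positives M = {m \<in> carrier M. \<^bold>0\<^bsub>M\<^esub> \<prec>\<^bsub>M\<^esub> m}"

locale dense_unital_magma = ordered_unital_magma +
  assumes dense: "\<epsilon> \<in> positives M \<Longrightarrow> \<exists>\<beta>\<in>positives M. \<exists>\<gamma>\<in>positives M. \<beta> \<star> \<gamma> \<prec> \<epsilon>"

text \<open>Groups are those of HOL-Algebra, written multiplicatively: the sum \<open>g + h\<close>, the
  difference \<open>g - h\<close> and the neutral element of \<open>G\<close> are \<open>g \<otimes> h\<close>, \<open>g \<otimes> inv h\<close> and \<open>\<one>\<close>.\<close>

locale magma_normed_group = ordered_unital_magma M + group G
  for M :: "('m, 'b) ord_magma_scheme" and G :: "('g, 'c) monoid_scheme" +
  fixes nrm :: "'g \<Rightarrow> 'm"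
  assumes nrm_closed: "g \<in> carrier G \<Longrightarrow> nrm g \<in> carrier M"
    and nrm_nonneg: "g \<in> carrier G \<Longrightarrow> \<^bold>0\<^bsub>M\<^esub> \<preceq>\<^bsub>M\<^esub> nrm g"
    and nrm_eq_zero: "g \<in> carrier G \<Longrightarrow> nrm g = \<^bold>0\<^bsub>M\<^esub> \<longleftrightarrow> g = \<one>\<^bsub>G\<^esub>"
    and nrm_diff: "\<lbrakk>g \<in> carrier G; h \<in> carrier G\<rbrakk>
      \<Longrightarrow> nrm (g \<otimes>\<^bsub>G\<^esub> inv\<^bsub>G\<^esub> h) \<preceq>\<^bsub>M\<^esub> nrm g \<star>\<^bsub>M\<^esub> nrm h"

definition Seq :: "('g, 'c) monoid_scheme \<Rightarrow> (nat \<Rightarrow> 'g) monoid"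
  where "Seq G = product_group UNIV (\<lambda>_. G)"

lemma carrier_Seq: "x \<in> carrier (Seq G) \<longleftrightarrow> (\<forall>n. x n \<in> carrier G)"
  by (auto simp: Seq_def PiE_iff)

lemma mult_Seq: "x \<otimes>\<^bsub>Seq G\<^esub> y = (\<lambda>n. x n \<otimes>\<^bsub>G\<^esub> y n)"
  by (auto simp: Seq_def)

lemma one_Seq: "\<one>\<^bsub>Seq G\<^esub> = (\<lambda>n. \<one>\<^bsub>G\<^esub>)"
  by (auto simp: Seq_def)

lemma comm_group_Seq:
  assumes "comm_group G"
  shows "comm_group (Seq G)"
proof -
  interpret comm_group G by (fact assms)
  have "group (Seq G)"
    by (simp add: Seq_def group_axioms)
  then show ?thesis
    by (rule group.group_comm_groupI) (auto simp: carrier_Seq mult_Seq m_comm)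
qed

definition converges_to ::
  "('m, 'b) ord_magma_scheme \<Rightarrow> ('g, 'c) monoid_scheme \<Rightarrow> ('g \<Rightarrow> 'm) \<Rightarrow> (nat \<Rightarrow> 'g) \<Rightarrow> 'g \<Rightarrow> bool"
  where "converges_to M G nrm x a \<longleftrightarrow>
    (\<forall>\<epsilon>\<in>positives M. \<exists>N. \<forall>n\<ge>N. nrm (x n \<otimes>\<^bsub>G\<^esub> inv\<^bsub>G\<^esub> a) \<prec>\<^bsub>M\<^esub> \<epsilon>)"

definition is_cauchy ::
  "('m, 'b) ord_magma_scheme \<Rightarrow> ('g, 'c) monoid_scheme \<Rightarrow> ('g \<Rightarrow> 'm) \<Rightarrow> (nat \<Rightarrow> 'g) \<Rightarrow> bool"
  where "is_cauchy M G nrm x \<longleftrightarrow>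
    (\<forall>\<epsilon>\<in>positives M. \<exists>N. \<forall>m\<ge>N. \<forall>n\<ge>N. nrm (x m \<otimes>\<^bsub>G\<^esub> inv\<^bsub>G\<^esub> x n) \<prec>\<^bsub>M\<^esub> \<epsilon>)"

definition CauchySeqs ::
  "('m, 'b) ord_magma_scheme \<Rightarrow> ('g, 'c) monoid_scheme \<Rightarrow> ('g \<Rightarrow> 'm) \<Rightarrow> (nat \<Rightarrow> 'g) set"
  where "CauchySeqs M G nrm = {x \<in> carrier (Seq G). is_cauchy M G nrm x}"

definition ConvSeqs ::
  "('m, 'b) ord_magma_scheme \<Rightarrow> ('g, 'c) monoid_scheme \<Rightarrow> ('g \<Rightarrow> 'm) \<Rightarrow> (nat \<Rightarrow> 'g) set"
  where "ConvSeqs M G nrm =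
    {x \<in> carrier (Seq G). \<exists>a\<in>carrier G. converges_to M G nrm x a}"

definition ZeroSeqs ::
  "('m, 'b) ord_magma_scheme \<Rightarrow> ('g, 'c) monoid_scheme \<Rightarrow> ('g \<Rightarrow> 'm) \<Rightarrow> (nat \<Rightarrow> 'g) set"
  where "ZeroSeqs M G nrm = {x \<in> ConvSeqs M G nrm. converges_to M G nrm x \<one>\<^bsub>G\<^esub>}"

end

theory Submission
  imports Defs
begin

text \<open>Convergence to \<open>a\<close> says that \<open>x\<^sub>n - a\<close> tends to zero along \<^const>\<open>sequentially\<close>, and being
  Cauchy says that \<open>x\<^sub>m - x\<^sub>n\<close> does so along the product filter. Density makes the families that tend
  to zero along a fixed filter closed under differences, and every closure property follows. Limits are
  unique because a norm below every positive element is not itself positive, hence zero; so the limit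
  map is a surjective homomorphism onto \<open>G\<close> with kernel \<open>Zero(G)\<close>.\<close>

section \<open>Preliminaries on groups, sequences and orders\<close>

lemma (in group) subgroup_diffI:
  assumes "H \<subseteq> carrier G" "\<one> \<in> H"
    and diff: "\<And>x y. x \<in> H \<Longrightarrow> y \<in> H \<Longrightarrow> x \<otimes> inv y \<in> H"
  shows "subgroup H G"
proof (rule subgroupI)
  \<comment> \<open>The norm axiom bounds differences only, so closure is tested on differences:
    \<open>inv y\<close> is \<open>\<one> \<otimes> inv y\<close>, and \<open>x \<otimes> y\<close>
    is \<open>x \<otimes> inv (inv y)\<close>.\<close>
  show inv: "inv y \<in> H" if "y \<in> H" for y
    using diff[OF \<open>\<one> \<in> H\<close> that] that \<open>H \<subseteq> carrier G\<close> by auto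
  show "x \<otimes> y \<in> H" if "x \<in> H" "y \<in> H" for x y
    using diff[OF that(1) inv[OF that(2)]] that \<open>H \<subseteq> carrier G\<close> by (simp add: subset_iff)
qed (use assms in auto)

lemma (in comm_group) diff_diff_swap:
  assumes [simp]: "a \<in> carrier G" "b \<in> carrier G" "c \<in> carrier G" "d \<in> carrier G"
  shows "(a \<otimes> inv b) \<otimes> inv (c \<otimes> inv d) = (a \<otimes> inv c) \<otimes> inv (b \<otimes> inv d)"
  by (simp add: inv_mult m_ac)

text \<open>The inverse of \<open>b \<otimes> inv c\<close> is \<open>c \<otimes> inv b\<close>, so
  the inner \<open>inv c\<close> and \<open>c\<close> meet and cancel. It serves to compare two
  terms of a sequence through its limit.\<close>

lemma (in group) diff_diff_cancel_right:
  assumes [simp]: "a \<in> carrier G" "b \<in> carrier G" "c \<in> carrier G"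
  shows "(a \<otimes> inv c) \<otimes> inv (b \<otimes> inv c) = a \<otimes> inv b"
proof -
  have "inv c \<otimes> (c \<otimes> inv b) = inv b"
    by (simp add: m_assoc[symmetric])
  then show ?thesis
    by (simp add: inv_mult_group m_assoc)
qed

lemma inv_Seq:
  assumes "group G" "x \<in> carrier (Seq G)"
  shows "inv\<^bsub>Seq G\<^esub> x = (\<lambda>n. inv\<^bsub>G\<^esub> x n)"
  using assms by (simp add: Seq_def restrict_UNIV)

text \<open>If \<open>a = c\<close>, then \<open>b\<close> would lie both above and below
  \<open>a\<close>, and antisymmetry would force \<open>b = c\<close>.\<close>

lemma (in ordered_unital_magma) le_less_trans:
  assumes "a \<in> carrier M" "b \<in> carrier M" "c \<in> carrier M" "a \<preceq> b" "b \<prec> c"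
  shows "a \<prec> c"
  using assms le_trans le_antisym
  by (auto simp: magma_less_def dest: transp_onD antisymp_onD)

lemma (in ordered_unital_magma) op_mono:
  assumes "a \<in> carrier M" "b \<in> carrier M" "c \<in> carrier M" "d \<in> carrier M" "a \<preceq> b" "c \<preceq> d"
  shows "a \<star> c \<preceq> b \<star> d"
proof (rule transp_onD[OF le_trans])
  show "a \<star> c \<preceq> b \<star> c" "b \<star> c \<preceq> b \<star> d"
    using assms op_right_mono op_left_mono by auto
qed (use assms op_closed in auto)

section \<open>Families tending to zero along a filter\<close>

locale dense_normed_group = magma_normed_group M G nrm + dense_unital_magma M + comm_group G
  for M :: "('m, 'b) ord_magma_scheme" and G :: "('g, 'c) monoid_scheme" and nrm :: "'g \<Rightarrow> 'm"
begin

definition tends_zero :: "('i \<Rightarrow> 'g) \<Rightarrow> 'i filter \<Rightarrow> bool"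
  where "tends_zero f F \<longleftrightarrow> (\<forall>\<epsilon>\<in>positives M. eventually (\<lambda>i. nrm (f i) \<prec>\<^bsub>M\<^esub> \<epsilon>) F)"

lemma tends_zero_one: "tends_zero (\<lambda>_. \<one>\<^bsub>G\<^esub>) F"
  by (simp add: tends_zero_def positives_def nrm_eq_zero[THEN iffD2])

text \<open>The usual halving of \<open>\<epsilon>\<close>, with density supplying
  \<open>\<beta>\<close> and \<open>\<gamma>\<close> in place of two halves.\<close>

lemma tends_zero_diff:
  assumes "tends_zero f F" "tends_zero g F"
    and [simp]: "\<And>i. f i \<in> carrier G" "\<And>i. g i \<in> carrier G"
  shows "tends_zero (\<lambda>i. f i \<otimes>\<^bsub>G\<^esub> inv\<^bsub>G\<^esub> g i) F"
  unfolding tends_zero_def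
proof
  fix \<epsilon> assume \<epsilon>: "\<epsilon> \<in> positives M"
  then obtain \<beta> \<gamma> where \<beta>\<gamma>: "\<beta> \<in> positives M" "\<gamma> \<in> positives M" "\<beta> \<star>\<^bsub>M\<^esub> \<gamma> \<prec>\<^bsub>M\<^esub> \<epsilon>"
    using dense by blast
  then have [simp]: "\<beta> \<in> carrier M" "\<gamma> \<in> carrier M" "\<epsilon> \<in> carrier M"
    using \<epsilon> by (auto simp: positives_def)
  have "eventually (\<lambda>i. nrm (f i) \<prec>\<^bsub>M\<^esub> \<beta>) F" "eventually (\<lambda>i. nrm (g i) \<prec>\<^bsub>M\<^esub> \<gamma>) F"
    using assms \<beta>\<gamma> by (auto simp: tends_zero_def)
  then show "eventually (\<lambda>i. nrm (f i \<otimes>\<^bsub>G\<^esub> inv\<^bsub>G\<^esub> g i) \<prec>\<^bsub>M\<^esub> \<epsilon>) F"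
  proof eventually_elim
    case (elim i)
    \<comment> \<open>Monotonicity of the operation is only weak, so the strict bounds are weakened
      here; strictness comes back from
      \<open>\<beta> \<star> \<gamma> \<prec> \<epsilon>\<close>.\<close>
    then have "nrm (f i) \<star>\<^bsub>M\<^esub> nrm (g i) \<preceq>\<^bsub>M\<^esub> \<beta> \<star>\<^bsub>M\<^esub> \<gamma>"
      by (intro op_mono) (auto simp: magma_less_def nrm_closed)
    then have "nrm (f i) \<star>\<^bsub>M\<^esub> nrm (g i) \<prec>\<^bsub>M\<^esub> \<epsilon>"
      using \<beta>\<gamma>(3) by (rule le_less_trans[rotated 3]) (auto simp: nrm_closed op_closed)
    with nrm_diff[of "f i" "g i"] show ?case
      by - (rule le_less_trans[of _ "nrm (f i) \<star>\<^bsub>M\<^esub> nrm (g i)"], auto simp: nrm_closed op_closed)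
  qed
qed

lemma tends_zero_compose:
  assumes "tends_zero f F" "filterlim h F F'"
  shows "tends_zero (\<lambda>i. f (h i)) F'"
  using assms by (auto simp: tends_zero_def intro: eventually_compose_filterlim)

lemma tends_zero_const_iff:
  assumes "F \<noteq> bot" "g \<in> carrier G"
  shows "tends_zero (\<lambda>_. g) F \<longleftrightarrow> g = \<one>\<^bsub>G\<^esub>"
proof
  assume tz: "tends_zero (\<lambda>_. g) F"
  \<comment> \<open>If \<open>nrm g\<close> were positive, it could be its own
    \<open>\<epsilon>\<close>; as \<open>F \<noteq> bot\<close>, a constant statement that holds
    eventually is true, which would give \<open>nrm g \<prec> nrm g\<close>.\<close>
  have "nrm g \<notin> positives M"
    using tz \<open>F \<noteq> bot\<close> by (auto simp: tends_zero_def magma_less_def)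
  then have "nrm g = \<^bold>0\<^bsub>M\<^esub>"
    using assms(2) nrm_nonneg nrm_closed by (auto simp: positives_def magma_less_def)
  then show "g = \<one>\<^bsub>G\<^esub>"
    using assms(2) nrm_eq_zero by blast
qed (use tends_zero_one in blast)

section \<open>Convergent and Cauchy sequences through null families\<close>

lemma converges_to_iff_tends_zero:
  "converges_to M G nrm x a \<longleftrightarrow> tends_zero (\<lambda>n. x n \<otimes>\<^bsub>G\<^esub> inv\<^bsub>G\<^esub> a) sequentially"
  by (simp add: converges_to_def tends_zero_def eventually_sequentially)

lemma is_cauchy_iff_tends_zero:
  "is_cauchy M G nrm x \<longleftrightarrow>
    tends_zero (\<lambda>(m, n). x m \<otimes>\<^bsub>G\<^esub> inv\<^bsub>G\<^esub> x n) (sequentially \<times>\<^sub>F sequentially)"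
  by (simp add: is_cauchy_def tends_zero_def eventually_prod_sequentially case_prod_unfold) blast

text \<open>By commutativity, the deviation of the difference from \<open>a \<otimes> inv b\<close>
  is the difference of the two deviations, to which \<open>tends_zero_diff\<close> applies.\<close>

lemma converges_to_diff:
  assumes "x \<in> carrier (Seq G)" "y \<in> carrier (Seq G)"
    and [simp]: "a \<in> carrier G" "b \<in> carrier G"
    and "converges_to M G nrm x a" "converges_to M G nrm y b"
  shows "converges_to M G nrm (\<lambda>n. x n \<otimes>\<^bsub>G\<^esub> inv\<^bsub>G\<^esub> y n) (a \<otimes>\<^bsub>G\<^esub> inv\<^bsub>G\<^esub> b)"
proof -
  have [simp]: "x n \<in> carrier G" "y n \<in> carrier G" for n
    using assms by (auto simp: carrier_Seq)
  have swap: "(x n \<otimes>\<^bsub>G\<^esub> inv\<^bsub>G\<^esub> a) \<otimes>\<^bsub>G\<^esub> inv\<^bsub>G\<^esub> (y n \<otimes>\<^bsub>G\<^esub> inv\<^bsub>G\<^esub> b)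
      = (x n \<otimes>\<^bsub>G\<^esub> inv\<^bsub>G\<^esub> y n) \<otimes>\<^bsub>G\<^esub> inv\<^bsub>G\<^esub> (a \<otimes>\<^bsub>G\<^esub> inv\<^bsub>G\<^esub> b)" for n
    by (rule diff_diff_swap) auto
  have "tends_zero (\<lambda>n. (x n \<otimes>\<^bsub>G\<^esub> inv\<^bsub>G\<^esub> a) \<otimes>\<^bsub>G\<^esub> inv\<^bsub>G\<^esub> (y n \<otimes>\<^bsub>G\<^esub> inv\<^bsub>G\<^esub> b)) sequentially"
    using assms by - (rule tends_zero_diff, auto simp: converges_to_iff_tends_zero)
  then show ?thesis
    by (simp only: converges_to_iff_tends_zero swap)
qed

lemma converges_to_const:
  assumes "a \<in> carrier G"
  shows "converges_to M G nrm (\<lambda>_. a) a"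
  using assms tends_zero_one by (simp add: converges_to_iff_tends_zero)

text \<open>Sums reduce to differences twice: first \<open>inv y\<close> is the difference of the
  constant sequence \<open>\<one>\<close> and \<open>y\<close>, then \<open>x \<otimes> y\<close> is
  the difference of \<open>x\<close> and \<open>inv y\<close>.\<close>

lemma converges_to_mult:
  assumes "x \<in> carrier (Seq G)" "y \<in> carrier (Seq G)"
    and [simp]: "a \<in> carrier G" "b \<in> carrier G"
    and "converges_to M G nrm x a" "converges_to M G nrm y b"
  shows "converges_to M G nrm (\<lambda>n. x n \<otimes>\<^bsub>G\<^esub> y n) (a \<otimes>\<^bsub>G\<^esub> b)"
proof -
  have [simp]: "x n \<in> carrier G" "y n \<in> carrier G" for n
    using assms by (auto simp: carrier_Seq)
  have "converges_to M G nrm (\<lambda>n. \<one>\<^bsub>G\<^esub> \<otimes>\<^bsub>G\<^esub> inv\<^bsub>G\<^esub> y n) (\<one>\<^bsub>G\<^esub> \<otimes>\<^bsub>G\<^esub> inv\<^bsub>G\<^esub> b)"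
    using assms by (intro converges_to_diff converges_to_const) (auto simp: carrier_Seq)
  then have "converges_to M G nrm (\<lambda>n. inv\<^bsub>G\<^esub> y n) (inv\<^bsub>G\<^esub> b)"
    by simp
  then have "converges_to M G nrm (\<lambda>n. x n \<otimes>\<^bsub>G\<^esub> inv\<^bsub>G\<^esub> (inv\<^bsub>G\<^esub> y n)) (a \<otimes>\<^bsub>G\<^esub> inv\<^bsub>G\<^esub> (inv\<^bsub>G\<^esub> b))"
    using assms by (intro converges_to_diff) (auto simp: carrier_Seq)
  then show ?thesis
    by simp
qed

text \<open>Subtracting \<open>x\<close> from itself leaves the constant sequence
  \<open>\<one>\<close>, which must then converge to \<open>a \<otimes> inv b\<close>.\<close>

lemma converges_to_unique:
  assumes "x \<in> carrier (Seq G)" and [simp]: "a \<in> carrier G" "b \<in> carrier G"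
    and "converges_to M G nrm x a" "converges_to M G nrm x b"
  shows "a = b"
proof -
  have "converges_to M G nrm (\<lambda>n. \<one>\<^bsub>G\<^esub>) (a \<otimes>\<^bsub>G\<^esub> inv\<^bsub>G\<^esub> b)"
    using converges_to_diff[of x x a b] assms by (simp add: carrier_Seq)
  \<comment> \<open>The deviation of \<open>\<one>\<close> from the limit is the inverse of that
    limit, a constant null family.\<close>
  then have "inv\<^bsub>G\<^esub> (a \<otimes>\<^bsub>G\<^esub> inv\<^bsub>G\<^esub> b) = \<one>\<^bsub>G\<^esub>"
    using tends_zero_const_iff[of sequentially "inv\<^bsub>G\<^esub> (a \<otimes>\<^bsub>G\<^esub> inv\<^bsub>G\<^esub> b)"]
    by (simp add: converges_to_iff_tends_zero)
  then show ?thesis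
    by (metis inv_eq_1_iff inv_closed inv_inv inv_equality m_closed \<open>a \<in> carrier G\<close> \<open>b \<in> carrier G\<close>)
qed

lemma converges_to_imp_is_cauchy:
  assumes "x \<in> carrier (Seq G)" and [simp]: "a \<in> carrier G" and "converges_to M G nrm x a"
  shows "is_cauchy M G nrm x"
proof -
  have [simp]: "x n \<in> carrier G" for n
    using assms by (auto simp: carrier_Seq)
  have x: "tends_zero (\<lambda>n. x n \<otimes>\<^bsub>G\<^esub> inv\<^bsub>G\<^esub> a) sequentially"
    using assms by (simp add: converges_to_iff_tends_zero)
  \<comment> \<open>Along the product filter both indices of a pair go to infinity, so the deviation
    of \<open>x\<close> from \<open>a\<close>, read at either index, is a null family of pairs; the
    difference of the two no longer contains \<open>a\<close>.\<close>
  have "filterlim fst sequentially (sequentially \<times>\<^sub>F sequentially)"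
    "filterlim snd sequentially (sequentially \<times>\<^sub>F sequentially)"
    by (auto simp: filterlim_def filtermap_fst_prod_filter filtermap_snd_prod_filter)
  note x_fst_snd = this[THEN tends_zero_compose[OF x]]
  have "tends_zero (\<lambda>p. (x (fst p) \<otimes>\<^bsub>G\<^esub> inv\<^bsub>G\<^esub> a) \<otimes>\<^bsub>G\<^esub> inv\<^bsub>G\<^esub> (x (snd p) \<otimes>\<^bsub>G\<^esub> inv\<^bsub>G\<^esub> a))
      (sequentially \<times>\<^sub>F sequentially)"
    using x_fst_snd by (rule tends_zero_diff) auto
  then show ?thesis
    by (simp add: is_cauchy_iff_tends_zero diff_diff_cancel_right case_prod_unfold)
qed

text \<open>The rearrangement from \<open>converges_to_diff\<close>, with the later terms
  \<open>x n\<close> and \<open>y n\<close> in the place of the limits.\<close>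

lemma is_cauchy_diff:
  assumes "x \<in> carrier (Seq G)" "y \<in> carrier (Seq G)"
    and "is_cauchy M G nrm x" "is_cauchy M G nrm y"
  shows "is_cauchy M G nrm (\<lambda>n. x n \<otimes>\<^bsub>G\<^esub> inv\<^bsub>G\<^esub> y n)"
proof -
  have [simp]: "x n \<in> carrier G" "y n \<in> carrier G" for n
    using assms by (auto simp: carrier_Seq)
  have swap: "(x m \<otimes>\<^bsub>G\<^esub> inv\<^bsub>G\<^esub> x n) \<otimes>\<^bsub>G\<^esub> inv\<^bsub>G\<^esub> (y m \<otimes>\<^bsub>G\<^esub> inv\<^bsub>G\<^esub> y n)
      = (x m \<otimes>\<^bsub>G\<^esub> inv\<^bsub>G\<^esub> y m) \<otimes>\<^bsub>G\<^esub> inv\<^bsub>G\<^esub> (x n \<otimes>\<^bsub>G\<^esub> inv\<^bsub>G\<^esub> y n)" for m n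
    by (rule diff_diff_swap) auto
  have "tends_zero (\<lambda>p. (x (fst p) \<otimes>\<^bsub>G\<^esub> inv\<^bsub>G\<^esub> x (snd p)) \<otimes>\<^bsub>G\<^esub> inv\<^bsub>G\<^esub> (y (fst p) \<otimes>\<^bsub>G\<^esub> inv\<^bsub>G\<^esub> y (snd p)))
      (sequentially \<times>\<^sub>F sequentially)"
    using assms by - (rule tends_zero_diff, auto simp: is_cauchy_iff_tends_zero case_prod_unfold)
  then show ?thesis
    by (simp only: is_cauchy_iff_tends_zero case_prod_unfold swap)
qed

section \<open>Cauchy and convergent sequences as subgroups\<close>

lemma comm_group_Seq_G: "comm_group (Seq G)"
  by (rule comm_group_Seq) (rule comm_group_axioms)

lemma group_Seq_G: "group (Seq G)"
  using comm_group_Seq_G by (rule comm_group.axioms)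

lemma diff_Seq:
  assumes "y \<in> carrier (Seq G)"
  shows "x \<otimes>\<^bsub>Seq G\<^esub> inv\<^bsub>Seq G\<^esub> y = (\<lambda>n. x n \<otimes>\<^bsub>G\<^esub> inv\<^bsub>G\<^esub> y n)"
  using assms by (simp add: mult_Seq inv_Seq)

lemma subgroup_CauchySeqs: "subgroup (CauchySeqs M G nrm) (Seq G)"
proof (rule group.subgroup_diffI[OF group_Seq_G])
  \<comment> \<open>A constant sequence converges, hence is Cauchy.\<close>
  have "is_cauchy M G nrm (\<lambda>_. \<one>\<^bsub>G\<^esub>)"
    using converges_to_imp_is_cauchy[OF _ _ converges_to_const] by (simp add: carrier_Seq)
  then show "\<one>\<^bsub>Seq G\<^esub> \<in> CauchySeqs M G nrm"
    by (simp add: CauchySeqs_def carrier_Seq one_Seq)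
qed (auto simp: CauchySeqs_def diff_Seq is_cauchy_diff carrier_Seq)

lemma subgroup_ConvSeqs: "subgroup (ConvSeqs M G nrm) (Seq G)"
proof (rule group.subgroup_diffI[OF group_Seq_G])
  show "\<one>\<^bsub>Seq G\<^esub> \<in> ConvSeqs M G nrm"
    using converges_to_const[of "\<one>\<^bsub>G\<^esub>"] by (auto simp: ConvSeqs_def carrier_Seq one_Seq)
  show "x \<otimes>\<^bsub>Seq G\<^esub> inv\<^bsub>Seq G\<^esub> y \<in> ConvSeqs M G nrm"
    if xy: "x \<in> ConvSeqs M G nrm" "y \<in> ConvSeqs M G nrm" for x y
  proof -
    obtain a b where "a \<in> carrier G" "b \<in> carrier G"
      "converges_to M G nrm x a" "converges_to M G nrm y b"
      using xy by (auto simp: ConvSeqs_def)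
    then have "converges_to M G nrm (\<lambda>n. x n \<otimes>\<^bsub>G\<^esub> inv\<^bsub>G\<^esub> y n) (a \<otimes>\<^bsub>G\<^esub> inv\<^bsub>G\<^esub> b)"
      using xy by (intro converges_to_diff) (auto simp: ConvSeqs_def)
    with \<open>a \<in> carrier G\<close> \<open>b \<in> carrier G\<close> xy show ?thesis
      by (auto simp: ConvSeqs_def diff_Seq carrier_Seq intro!: bexI[of _ "a \<otimes>\<^bsub>G\<^esub> inv\<^bsub>G\<^esub> b"])
  qed
qed (auto simp: ConvSeqs_def)

lemma ConvSeqs_subset_CauchySeqs: "ConvSeqs M G nrm \<subseteq> CauchySeqs M G nrm"
  using converges_to_imp_is_cauchy by (auto simp: ConvSeqs_def CauchySeqs_def)

section \<open>The limit homomorphism, its kernel and its image\<close>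

definition seq_limit :: "(nat \<Rightarrow> 'g) \<Rightarrow> 'g"
  where "seq_limit x = (THE a. a \<in> carrier G \<and> converges_to M G nrm x a)"

text \<open>Uniqueness of limits makes the definite description proper on convergent sequences, the
  only ones on which \<open>seq_limit\<close> is evaluated.\<close>

lemma seq_limit_eq:
  assumes "x \<in> carrier (Seq G)" "a \<in> carrier G" "converges_to M G nrm x a"
  shows "seq_limit x = a"
  unfolding seq_limit_def using assms converges_to_unique by blast

lemma ConvSeqsD:
  assumes "x \<in> ConvSeqs M G nrm"
  shows "x \<in> carrier (Seq G)" "seq_limit x \<in> carrier G" "converges_to M G nrm x (seq_limit x)"
proof -
  obtain a where "x \<in> carrier (Seq G)" "a \<in> carrier G" "converges_to M G nrm x a"
    using assms by (auto simp: ConvSeqs_def)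
  moreover from this have "seq_limit x = a"
    by (rule seq_limit_eq)
  ultimately show "x \<in> carrier (Seq G)" "seq_limit x \<in> carrier G"
    "converges_to M G nrm x (seq_limit x)"
    by simp_all
qed

text \<open>The sum of the limits is a limit of the sum, and by uniqueness it is the value of
  \<open>seq_limit\<close> there.\<close>

lemma group_hom_seq_limit:
  "group_hom ((Seq G)\<lparr>carrier := ConvSeqs M G nrm\<rparr>) G seq_limit"
proof (intro group_hom.intro group_hom_axioms.intro homI)
  show "group ((Seq G)\<lparr>carrier := ConvSeqs M G nrm\<rparr>)"
    using group.subgroup_imp_group[OF group_Seq_G subgroup_ConvSeqs] .
  show "seq_limit (x \<otimes>\<^bsub>(Seq G)\<lparr>carrier := ConvSeqs M G nrm\<rparr>\<^esub> y) = seq_limit x \<otimes>\<^bsub>G\<^esub> seq_limit y"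
    if "x \<in> carrier ((Seq G)\<lparr>carrier := ConvSeqs M G nrm\<rparr>)"
      "y \<in> carrier ((Seq G)\<lparr>carrier := ConvSeqs M G nrm\<rparr>)" for x y
  proof -
    have xy: "x \<in> ConvSeqs M G nrm" "y \<in> ConvSeqs M G nrm"
      using that by auto
    have "x \<otimes>\<^bsub>Seq G\<^esub> y \<in> carrier (Seq G)"
      using xy[THEN ConvSeqsD(1)] by (simp add: carrier_Seq mult_Seq)
    moreover have "converges_to M G nrm (x \<otimes>\<^bsub>Seq G\<^esub> y) (seq_limit x \<otimes>\<^bsub>G\<^esub> seq_limit y)"
      unfolding mult_Seq using xy[THEN ConvSeqsD(1)] xy[THEN ConvSeqsD(2)] xy[THEN ConvSeqsD(3)]
      by (rule converges_to_mult)
    ultimately show ?thesis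
      using xy[THEN ConvSeqsD(2)] by (simp add: seq_limit_eq)
  qed
qed (auto simp: ConvSeqsD group_axioms)

text \<open>Serves twice: as a kernel, \<open>ZeroSeqs M G nrm\<close> is a subgroup of the
  convergent sequences, and it is the subgroup that the isomorphism theorem divides out.\<close>

lemma kernel_seq_limit:
  "kernel ((Seq G)\<lparr>carrier := ConvSeqs M G nrm\<rparr>) G seq_limit = ZeroSeqs M G nrm"
proof -
  have "seq_limit x = \<one>\<^bsub>G\<^esub> \<longleftrightarrow> converges_to M G nrm x \<one>\<^bsub>G\<^esub>" if "x \<in> ConvSeqs M G nrm" for x
    using ConvSeqsD[OF that] seq_limit_eq[of x \<open>\<one>\<^bsub>G\<^esub>\<close>] by auto
  then show ?thesis
    by (auto simp: kernel_def ZeroSeqs_def)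
qed

lemma seq_limit_image: "seq_limit ` ConvSeqs M G nrm = carrier G"
proof
  show "carrier G \<subseteq> seq_limit ` ConvSeqs M G nrm"
  proof
    fix a assume a: "a \<in> carrier G"
    \<comment> \<open>The constant sequence is the preimage of \<open>a\<close>.\<close>
    then have "(\<lambda>_. a) \<in> ConvSeqs M G nrm" "seq_limit (\<lambda>_. a) = a"
      using converges_to_const by (auto simp: ConvSeqs_def carrier_Seq intro!: seq_limit_eq)
    then show "a \<in> seq_limit ` ConvSeqs M G nrm"
      by (metis imageI)
  qed
qed (auto simp: ConvSeqsD)

end

theorem theorem4p6:
  fixes M :: "('m, 'b) ord_magma_scheme"
    and G :: "('g, 'c) monoid_scheme"
    and nrm :: "'g \<Rightarrow> 'm"
  assumes "dense_unital_magma M"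
    and "comm_group G"
    and "magma_normed_group M G nrm"
  shows "subgroup (CauchySeqs M G nrm) (Seq G)
    \<and> (\<forall>x\<in>carrier (Seq G). \<forall>y\<in>carrier (Seq G). \<forall>a\<in>carrier G. \<forall>b\<in>carrier G.
      converges_to M G nrm x a \<and> converges_to M G nrm y b \<longrightarrow>
      converges_to M G nrm (\<lambda>n. x n \<otimes>\<^bsub>G\<^esub> y n) (a \<otimes>\<^bsub>G\<^esub> b))
    \<and> subgroup (ConvSeqs M G nrm) ((Seq G)\<lparr>carrier := CauchySeqs M G nrm\<rparr>)
    \<and> subgroup (ZeroSeqs M G nrm) ((Seq G)\<lparr>carrier := ConvSeqs M G nrm\<rparr>)
    \<and> (Seq G)\<lparr>carrier := ConvSeqs M G nrm\<rparr> Mod ZeroSeqs M G nrm \<cong> G"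
proof -
  interpret magma_normed_group M G nrm by (fact assms)
  interpret dense_unital_magma M by (fact assms)
  interpret comm_group G by (fact assms)
  interpret dense_normed_group M G nrm ..
  interpret lim: group_hom "(Seq G)\<lparr>carrier := ConvSeqs M G nrm\<rparr>" G seq_limit
    by (rule group_hom_seq_limit)
  \<comment> \<open>Both sets are subgroups of \<open>Seq G\<close>, so the inclusion of one in the
    other suffices.\<close>
  have "subgroup (ConvSeqs M G nrm) ((Seq G)\<lparr>carrier := CauchySeqs M G nrm\<rparr>)"
    by (intro group.subgroup_incl group_Seq_G subgroup_ConvSeqs subgroup_CauchySeqs
        ConvSeqs_subset_CauchySeqs)
  \<comment> \<open>First isomorphism theorem for the surjective limit map.\<close>
  moreover have "(Seq G)\<lparr>carrier := ConvSeqs M G nrm\<rparr> Mod ZeroSeqs M G nrm \<cong> G"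
    using lim.FactGroup_iso seq_limit_image by (simp add: kernel_seq_limit)
  ultimately show ?thesis
    using subgroup_CauchySeqs converges_to_mult lim.subgroup_kernel
    by (auto simp: kernel_seq_limit)
qed

end
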